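(* Let $m\in\mathbb{Q}_{>0}$. The map $\psi_{\sqcup\!\sqcup,m}:\mathbb{Q}[\mu]\langle X^\mu\rangle^0[T]\to\mathbb{Q}[\mu]\langle X^\mu\rangle^1$, $\sum_iw_iT^i\mapsto\sum_iw_i\sqcup\!\sqcup(y^\mu_m)^{\sqcup\!\sqcup i}$ (where $(y^\mu_m)^{\sqcup\!\sqcup i}$ is the $i$-fold shuffle power, and the polynomial ring is taken over the commutative algebra $(\mathbb{Q}[\mu]\langle X^\mu\rangle^0,\sqcup\!\sqcup)$), is an isomorphism of $(\mathbb{Q}[\mu]\langle X^\mu\rangle^0,\sqcup\!\sqcup)$-algebras onto $(\mathbb{Q}[\mu]\langle X^\mu\rangle^1,\sqcup\!\sqcup)$.
   Context: Fix $\mu\in\mathbb{C}$, $\mathrm{Re}(\mu)>0$; $\mathbb{Q}[\mu]\subset\mathbb{C}$ the ring generated by $\mu$. $X^\mu=\{x\}\cup\{y^\mu_l:l\in\mathbb{Q}\}$; $\mathbb{Q}[\mu]\langle X^\mu\rangle$ is the free $\mathbb{Q}[\mu]$-module on words over $X^\mu$ (empty word $1$). The shuffle product $\sqcup\!\sqcup$ is $\mathbb{Q}[\mu]$-bilinear with $1\sqcup\!\sqcup w=w\sqcup\!\sqcup1=w$ and $w_1u\sqcup\!\sqcup w_2v=(w_1\sqcup\!\sqcup w_2v)u+(w_1u\sqcup\!\sqcup w_2)v$ for letters $u,v$ and words $w_1,w_2$; it is commutative and associative. A bi-index $(\mathbf{k};\mathbf{m})\in\mathbb{N}^r\times\mathbb{Q}^r$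 is positive if all $m_i>0$ and admissible if moreover $k_r>1$; put $(y,x)^\mu_{\mathbf{k};\mathbf{m}}=y^\mu_{m_1}x^{k_1-1}y^\mu_{m_2-m_1}x^{k_2-1}\cdots y^\mu_{m_r-m_{r-1}}x^{k_r-1}$. $\mathbb{Q}[\mu]\langle X^\mu\rangle^1$ is the span of all words $y^\mu_{l_1}x^{t_1}\cdots y^\mu_{l_r}x^{t_r}$ ($r\ge0,t_i\ge0$) with $l_1+\dots+l_i>0$ for all $i$. $\mathbb{Q}[\mu]\langle X^\mu\rangle^0$ is the span of $1$, all $(y,x)^\mu_{\mathbf{k};\mathbf{m}}$ with $(\mathbf{k};\mathbf{m})$ admissible, and all $(y,x)^\mu_{\mathbf{k};\mathbf{m}}-(y,x)^\mu_{\mathbf{k};\tilde{\mathbf{m}}}$ where $\mathbf{k}=(k_1,\dots,k_{r-1},1)$, $\mathbf{m}=(m_1,\dots,m_r)$, $\tilde{\mathbf{m}}=(m_1,\dots,m_{r-1},\tilde m_r)$, all entries in $\mathbb{Q}_{>0}$, $\tilde m_r\ne m_r$; it is a $\sqcup\!\sqcup$-subalgebra of $\mathbb{Q}[\mu]\langle X^\mu\rangle^1$. *)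

theory Defs
  imports
    Complex_Main
    "HOL-Library.Poly_Mapping"
    "HOL-Computational_Algebra.Polynomial"
    "HOL-Algebra.UnivPoly"
    "HOL-Algebra.QuotRing"
begin

definition Q_adjoin :: "complex \<Rightarrow> complex set" where
  "Q_adjoin \<mu> = range (\<lambda>p :: rat poly. poly (map_poly of_rat p) \<mu>)"

text \<open>
  The letters \<open>Y l\<close> are formal symbols, so the superscript \<open>\<mu>\<close> is dropped from them;
  \<open>\<mu>\<close> enters only through the coefficient ring. All computations take place in the free
  \<open>\<complex>\<close>-module on words; the \<open>\<rat>[\<mu>]\<close>-modules of the statement are the \<open>\<rat>[\<mu>]\<close>-spans of
  sets of elements with coefficients \<open>0, 1, -1\<close>, and so lie inside \<open>\<rat>[\<mu>]\<langle>X\<rangle>\<close>.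
\<close>

datatype letter = X | Y rat

type_synonym word = "letter list"
type_synonym ncpoly = "word \<Rightarrow>\<^sub>0 complex"

abbreviation word_elem :: "word \<Rightarrow> ncpoly" where
  "word_elem w \<equiv> Poly_Mapping.single w 1"

definition scale :: "complex \<Rightarrow> ncpoly \<Rightarrow> ncpoly" where
  "scale c p = Poly_Mapping.map ((*) c) p"

definition span_over :: "complex set \<Rightarrow> ncpoly set \<Rightarrow> ncpoly set" where
  "span_over R S =
     {\<Sum>s\<in>F. scale (c s) s | F c. finite F \<and> F \<subseteq> S \<and> (\<forall>s\<in>F. c s \<in> R)}"

definition append_letter :: "ncpoly \<Rightarrow> letter \<Rightarrow> ncpoly" where
  "append_letter p u = (\<Sum>w\<in>Poly_Mapping.keys p. Poly_Mapping.single (w @ [u]) (Poly_Mapping.lookup p w))"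

function shuffle_word :: "word \<Rightarrow> word \<Rightarrow> ncpoly" where
  "shuffle_word [] w = word_elem w"
| "shuffle_word w [] = word_elem w"
| "shuffle_word (w\<^sub>1 @ [u]) (w\<^sub>2 @ [v]) =
     append_letter (shuffle_word w\<^sub>1 (w\<^sub>2 @ [v])) u
   + append_letter (shuffle_word (w\<^sub>1 @ [u]) w\<^sub>2) v"
proof -
  fix P and x :: "word \<times> word"
  assume "\<And>w. x = ([], w) \<Longrightarrow> P" "\<And>w. x = (w, []) \<Longrightarrow> P"
    "\<And>w\<^sub>1 u w\<^sub>2 v. x = (w\<^sub>1 @ [u], w\<^sub>2 @ [v]) \<Longrightarrow> P"
  then show P
    by (metis rev_exhaust surj_pair)
qed auto
termination
  by (relation "measure (\<lambda>(a, b). length a + length b)") auto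

definition shuffle :: "ncpoly \<Rightarrow> ncpoly \<Rightarrow> ncpoly" where
  "shuffle p q = (\<Sum>u\<in>Poly_Mapping.keys p. \<Sum>v\<in>Poly_Mapping.keys q.
     scale (Poly_Mapping.lookup p u * Poly_Mapping.lookup q v) (shuffle_word u v))"

text \<open>
  A bi-index is a pair of lists of equal length, the first with entries \<open>\<ge> 1\<close>. In \<open>yx_word\<close> the
  value \<open>m\<^sub>0\<close> is taken to be \<open>0\<close>.
\<close>

definition bi_index :: "nat list \<Rightarrow> rat list \<Rightarrow> bool" where
  "bi_index ks ms \<longleftrightarrow> length ks = length ms \<and> (\<forall>k\<in>set ks. k \<ge> 1)"

definition positive_bi_index :: "nat list \<Rightarrow> rat list \<Rightarrow> bool" where
  "positive_bi_index ks ms \<longleftrightarrow> bi_index ks ms \<and> (\<forall>m\<in>set ms. m > 0)"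

definition admissible_bi_index :: "nat list \<Rightarrow> rat list \<Rightarrow> bool" where
  "admissible_bi_index ks ms \<longleftrightarrow> positive_bi_index ks ms \<and> ks \<noteq> [] \<and> last ks > 1"

definition yx_word :: "nat list \<Rightarrow> rat list \<Rightarrow> word" where
  "yx_word ks ms = concat (map
     (\<lambda>i. Y (ms ! i - (if i = 0 then 0 else ms ! (i - 1))) # replicate (ks ! i - 1) X)
     [0..<length ks])"

definition generators1 :: "ncpoly set" where
  "generators1 =
     {word_elem (concat (map (\<lambda>(l, t). Y l # replicate t X) (zip ls ts))) | ls ts.
        length ls = length ts \<and> (\<forall>i\<in>{1..length ls}. sum_list (take i ls) > 0)}"

definition generators0 :: "ncpoly set" where
  "generators0 =
     {word_elem []}
   \<union> {word_elem (yx_word ks ms) | ks ms. admissible_bi_index ks ms}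
   \<union> {word_elem (yx_word (ks @ [1]) (ms @ [m])) - word_elem (yx_word (ks @ [1]) (ms @ [m'])) | ks ms m m'.
        positive_bi_index (ks @ [1]) (ms @ [m]) \<and>
        positive_bi_index (ks @ [1]) (ms @ [m']) \<and> m' \<noteq> m}"

text \<open>
  The scalar multiplication is by elements of the same algebra, so that \<open>algebra1 \<mu>\<close> is an algebra
  over its subalgebra \<open>algebra0 \<mu>\<close>.
\<close>

definition shuffle_algebra :: "ncpoly set \<Rightarrow> (ncpoly, ncpoly) module" where
  "shuffle_algebra S =
     \<lparr>carrier = S, monoid.mult = shuffle, one = word_elem [], zero = 0, add = (+),
      module.smult = shuffle\<rparr>"

definition algebra0 :: "complex \<Rightarrow> (ncpoly, ncpoly) module" where
  "algebra0 \<mu> = shuffle_algebra (span_over (Q_adjoin \<mu>) generators0)"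

definition algebra1 :: "complex \<Rightarrow> (ncpoly, ncpoly) module" where
  "algebra1 \<mu> = shuffle_algebra (span_over (Q_adjoin \<mu>) generators1)"

definition psi :: "complex \<Rightarrow> rat \<Rightarrow> (nat \<Rightarrow> ncpoly) \<Rightarrow> ncpoly" where
  "psi \<mu> m p = (\<Sum>i\<le>deg (algebra0 \<mu>) p.
     shuffle (up_ring.coeff (UP (algebra0 \<mu>)) p i) (word_elem [Y m] [^]\<^bsub>algebra1 \<mu>\<^esub> i))"

definition algebra_iso ::
  "('r, 'k) ring_scheme \<Rightarrow> ('r, 'a, 'm) module_scheme \<Rightarrow> ('r, 'b, 'n) module_scheme \<Rightarrow> ('a \<Rightarrow> 'b) \<Rightarrow> bool" where
  "algebra_iso R A B h \<longleftrightarrow>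
     algebra R A \<and> algebra R B \<and> h \<in> ring_iso A B \<and>
     (\<forall>r\<in>carrier R. \<forall>a\<in>carrier A. h (r \<odot>\<^bsub>A\<^esub> a) = r \<odot>\<^bsub>B\<^esub> h a)"

end

theory Submission
  imports Defs
begin

text \<open>
  Deleting a final letter \<open>Y l\<close> (and killing words that do not end in such a letter) is a
  derivation \<open>D\<close> of the shuffle algebra. On the span of the words with positive prefix weights it
  is locally nilpotent, its kernel is the span of \<open>generators0\<close>, and \<open>D y\<^sub>m = 1\<close>. Over a ring
  containing the rationals, a locally nilpotent derivation with such a slice \<open>y\<^sub>m\<close> makes the algebra
  a polynomial ring in \<open>y\<^sub>m\<close> over the kernel: differentiating gives uniqueness of the expansion,
  integrating term by term gives existence.
\<close>

section \<open>Linear extension of maps on words\<close>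

text \<open>The shuffle recursion splits off last letters, so each of its two summands shows which
  factor has supplied the last letter. This is why deletion of a last letter obeys the Leibniz rule,
  and why inductions on words add letters at the right end.

  The obstacle is that both modules are given as spans of parametrised families. They are replaced
  by descriptions through support and coefficients. The key notion is the weight of a word, the sum
  of the indices of its letters \<open>Y\<close>: a block word belongs to the larger module if all
  its nonempty prefixes have positive weight. The entries of a bi-index are these prefix weights at
  the ends of the blocks, because the word carries their differences. A prefix of an interleaving is
  an interleaving of prefixes, and weights add; hence positivity survives shuffling. That the
  smaller module is closed under shuffling comes from the Leibniz rule.

  Multiplicativity of \<open>psi\<close> is not checked on sums: \<open>psi\<close> is recognised as
  the evaluation homomorphism of the polynomial ring at the slice.\<close>

lemma lookup_scale [simp]: "Poly_Mapping.lookup (scale c p) w = c * Poly_Mapping.lookup p w"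
  by (auto simp: scale_def Poly_Mapping.map.rep_eq when_def)

lemma scale_add_right: "scale c (p + q) = scale c p + scale c q"
  by (rule poly_mapping_eqI) (simp add: lookup_add algebra_simps)

lemma scale_add_left: "scale (c + d) p = scale c p + scale d p"
  by (rule poly_mapping_eqI) (simp add: lookup_add algebra_simps)

lemma scale_scale [simp]: "scale c (scale d p) = scale (c * d) p"
  by (rule poly_mapping_eqI) simp

lemma scale_1 [simp]: "scale 1 p = p"
  by (rule poly_mapping_eqI) simp

lemma scale_0 [simp]: "scale 0 p = 0"
  by (rule poly_mapping_eqI) simp

lemma scale_zero [simp]: "scale c 0 = 0"
  by (rule poly_mapping_eqI) simp

lemma scale_minus_1: "scale (- 1) p = - p"
  by (rule poly_mapping_eqI) simp

lemma scale_sum: "scale c (sum f A) = (\<Sum>a\<in>A. scale c (f a))"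
  by (induction A rule: infinite_finite_induct) (simp_all add: scale_add_right)

lemma single_eq_scale: "Poly_Mapping.single w c = scale c (word_elem w)"
  by (rule poly_mapping_eqI) (simp add: lookup_single when_def)

definition lin_ext :: "(word \<Rightarrow> ncpoly) \<Rightarrow> ncpoly \<Rightarrow> ncpoly" where
  "lin_ext f p = (\<Sum>w\<in>Poly_Mapping.keys p. scale (Poly_Mapping.lookup p w) (f w))"

text \<open>Supports of sums and multiples are only contained in the expected sets, since terms may
  cancel. Linearity is therefore proved by comparing sums over a common finite superset of the
  supports.\<close>

lemma lin_ext_superset:
  assumes "finite A" "Poly_Mapping.keys p \<subseteq> A"
  shows "lin_ext f p = (\<Sum>w\<in>A. scale (Poly_Mapping.lookup p w) (f w))"
  unfolding lin_ext_def
  by (rule sum.mono_neutral_left) (use assms in \<open>auto simp: in_keys_iff\<close>)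

lemma lin_ext_word_elem [simp]: "lin_ext f (word_elem w) = f w"
  by (simp add: lin_ext_def)

lemma lin_ext_zero [simp]: "lin_ext f 0 = 0"
  by (simp add: lin_ext_def)

lemma lin_ext_add: "lin_ext f (p + q) = lin_ext f p + lin_ext f q"
proof -
  let ?A = "Poly_Mapping.keys p \<union> Poly_Mapping.keys q"
  have "Poly_Mapping.keys (p + q) \<subseteq> ?A"
    by (rule Poly_Mapping.keys_add)
  then show ?thesis
    by (simp add: lin_ext_superset[of ?A] lookup_add scale_add_left sum.distrib)
qed

lemma lin_ext_scale: "lin_ext f (scale c p) = scale c (lin_ext f p)"
proof -
  have "Poly_Mapping.keys (scale c p) \<subseteq> Poly_Mapping.keys p"
    by (auto simp: in_keys_iff)
  then show ?thesis
    by (simp add: lin_ext_superset[of "Poly_Mapping.keys p"] scale_sum)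
qed

lemma lin_ext_uminus: "lin_ext f (- p) = - lin_ext f p"
  using lin_ext_scale[of f "- 1" p] by (simp add: scale_minus_1)

lemma lin_ext_diff: "lin_ext f (p - q) = lin_ext f p - lin_ext f q"
  using lin_ext_add[of f p "- q"] by (simp add: lin_ext_uminus)

lemma lin_ext_sum: "lin_ext f (sum g A) = (\<Sum>a\<in>A. lin_ext f (g a))"
  by (induction A rule: infinite_finite_induct) (simp_all add: lin_ext_add)

lemma lin_ext_id [simp]: "lin_ext word_elem p = p"
proof (rule poly_mapping_eqI)
  fix w
  have "Poly_Mapping.lookup (lin_ext word_elem p) w =
      (\<Sum>v\<in>Poly_Mapping.keys p. if v = w then Poly_Mapping.lookup p v else 0)"
    unfolding lin_ext_def lookup_sum
    by (rule sum.cong) (auto simp: lookup_single when_def)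
  then show "Poly_Mapping.lookup (lin_ext word_elem p) w = Poly_Mapping.lookup p w"
    by (simp add: in_keys_iff)
qed

lemma lin_ext_add_fun: "lin_ext (\<lambda>w. f w + g w) p = lin_ext f p + lin_ext g p"
  by (simp add: lin_ext_def scale_add_right sum.distrib)

lemma lin_ext_scale_fun: "lin_ext (\<lambda>w. scale c (f w)) p = scale c (lin_ext f p)"
  by (simp add: lin_ext_def scale_sum mult.commute)

lemma lin_ext_diff_fun: "lin_ext (\<lambda>w. f w - g w) p = lin_ext f p - lin_ext g p"
  using lin_ext_add_fun[of "\<lambda>w. f w - g w" g p] by simp

lemma lin_ext_lin_ext: "lin_ext f (lin_ext g p) = lin_ext (\<lambda>w. lin_ext f (g w)) p"
  unfolding lin_ext_def[of g p] lin_ext_def[of "\<lambda>w. lin_ext f (g w)" p]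
  by (simp only: lin_ext_sum lin_ext_scale)

lemma lookup_lin_ext:
  "Poly_Mapping.lookup (lin_ext f p) w =
    (\<Sum>v\<in>Poly_Mapping.keys p. Poly_Mapping.lookup p v * Poly_Mapping.lookup (f v) w)"
  by (simp add: lin_ext_def lookup_sum)

lemma keys_lin_extE:
  assumes "w \<in> Poly_Mapping.keys (lin_ext f p)"
  obtains v where "v \<in> Poly_Mapping.keys p" "w \<in> Poly_Mapping.keys (f v)"
proof -
  have "\<exists>v\<in>Poly_Mapping.keys p. Poly_Mapping.lookup (f v) w \<noteq> 0"
  proof (rule ccontr)
    assume "\<not> ?thesis"
    then have "Poly_Mapping.lookup (lin_ext f p) w = 0"
      by (simp add: lookup_lin_ext)
    with assms show False
      by (simp add: in_keys_iff)
  qed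
  then show ?thesis
    using that by (auto simp: in_keys_iff)
qed

text \<open>Reduces identities that are linear in an argument to words, by one nested induction for
  each argument. The zero element is covered by scaling a word by 0.\<close>

lemma ncpoly_induct [case_names word add scale]:
  assumes "\<And>w. P (word_elem w)"
    and "\<And>p q. P p \<Longrightarrow> P q \<Longrightarrow> P (p + q)"
    and "\<And>c p. P p \<Longrightarrow> P (scale c p)"
  shows "P p"
proof -
  have P0: "P 0"
    using assms(3)[OF assms(1), of 0] by simp
  have "P (\<Sum>w\<in>A. scale (Poly_Mapping.lookup p w) (word_elem w))" for A
  proof (induction A rule: infinite_finite_induct)
    case (insert w A)
    show ?case
      unfolding sum.insert[OF insert.hyps] by (intro assms(2) assms(3) assms(1) insert.IH)
  qed (simp_all only: sum.infinite sum.empty P0 simp_thms)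
  from this[of "Poly_Mapping.keys p"] show ?thesis
    using lin_ext_id[of p] unfolding lin_ext_def by simp
qed

section \<open>The shuffle product\<close>

lemma append_letter_eq: "append_letter p u = lin_ext (\<lambda>w. word_elem (w @ [u])) p"
  by (simp add: append_letter_def lin_ext_def flip: single_eq_scale)

lemma shuffle_eq: "shuffle p q = lin_ext (\<lambda>u. lin_ext (shuffle_word u) q) p"
  by (simp add: shuffle_def lin_ext_def scale_sum)

lemma append_letter_word_elem [simp]: "append_letter (word_elem w) u = word_elem (w @ [u])"
  by (simp add: append_letter_eq)

lemma append_letter_add: "append_letter (p + q) u = append_letter p u + append_letter q u"
  by (simp add: append_letter_eq lin_ext_add)

lemma append_letter_scale: "append_letter (scale c p) u = scale c (append_letter p u)"
  by (simp add: append_letter_eq lin_ext_scale)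

lemma shuffle_word_elem [simp]: "shuffle (word_elem u) (word_elem v) = shuffle_word u v"
  by (simp add: shuffle_eq)

lemma shuffle_add_left: "shuffle (p + q) r = shuffle p r + shuffle q r"
  by (simp add: shuffle_eq lin_ext_add)

lemma shuffle_add_right: "shuffle p (q + r) = shuffle p q + shuffle p r"
  by (simp add: shuffle_eq lin_ext_add lin_ext_add_fun)

lemma shuffle_scale_left: "shuffle (scale c p) q = scale c (shuffle p q)"
  by (simp add: shuffle_eq lin_ext_scale)

lemma shuffle_scale_right: "shuffle p (scale c q) = scale c (shuffle p q)"
  by (simp add: shuffle_eq lin_ext_scale lin_ext_scale_fun)

lemmas shuffle_linear =
  shuffle_add_left shuffle_add_right shuffle_scale_left shuffle_scale_right

lemma shuffle_zero_left [simp]: "shuffle 0 p = 0"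
  by (simp add: shuffle_eq)

lemma shuffle_word_Nil_right [simp]: "shuffle_word w [] = word_elem w"
  by (cases w) (simp_all add: shuffle_word.simps(1,2))

lemma shuffle_word_commute: "shuffle_word u v = shuffle_word v u"
  by (induction u v rule: shuffle_word.induct) (simp_all add: add.commute)

lemma shuffle_commute: "shuffle p q = shuffle q p"
proof (induction p rule: ncpoly_induct)
  case (word w)
  show ?case
    by (induction q rule: ncpoly_induct) (simp_all add: shuffle_linear shuffle_word_commute)
qed (simp_all add: shuffle_linear)

lemma shuffle_one_left [simp]: "shuffle (word_elem []) p = p"
  by (induction p rule: ncpoly_induct) (simp_all add: shuffle_linear)

lemma shuffle_one_right [simp]: "shuffle p (word_elem []) = p"
  by (metis shuffle_commute shuffle_one_left)

lemma shuffle_zero_right [simp]: "shuffle p 0 = 0"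
  by (metis shuffle_commute shuffle_zero_left)

text \<open>By bilinearity the recursion extends from words to all elements. Associativity needs
  this form, because a product of two words is no longer a word.\<close>

lemma shuffle_append_letter:
  "shuffle (append_letter p u) (append_letter q v) =
    append_letter (shuffle p (append_letter q v)) u + append_letter (shuffle (append_letter p u) q) v"
proof (induction p rule: ncpoly_induct)
  case (word w)
  show ?case
    by (induction q rule: ncpoly_induct)
       (simp_all add: shuffle_linear append_letter_add append_letter_scale scale_add_right algebra_simps)
qed (simp_all add: shuffle_linear append_letter_add append_letter_scale scale_add_right algebra_simps)

text \<open>Both sides split into three parts according to which of the three words supplies the
  last letter. In each part one factor has lost its last letter, so the induction on the total
  length applies.\<close>

lemma shuffle_assoc_word:
  "shuffle (shuffle (word_elem a) (word_elem b)) (word_elem c) =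
    shuffle (word_elem a) (shuffle (word_elem b) (word_elem c))"
proof (induction "length a + length b + length c" arbitrary: a b c rule: less_induct)
  case less
  show ?case
  proof (cases "a = [] \<or> b = [] \<or> c = []")
    case True
    then show ?thesis
      by (auto simp del: shuffle_word_elem)
  next
    case False
    then obtain a' u b' v c' w where eq: "a = a' @ [u]" "b = b' @ [v]" "c = c' @ [w]"
      by (metis rev_exhaust)
    let ?A = "word_elem a" and ?B = "word_elem b" and ?C = "word_elem c"
    let ?A' = "word_elem a'" and ?B' = "word_elem b'" and ?C' = "word_elem c'"
    have ABC: "?A = append_letter ?A' u" "?B = append_letter ?B' v" "?C = append_letter ?C' w"
      by (simp_all add: eq)
    have AB: "shuffle ?A ?B = append_letter (shuffle ?A' ?B) u + append_letter (shuffle ?A ?B') v"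
      unfolding ABC by (rule shuffle_append_letter)
    have BC: "shuffle ?B ?C = append_letter (shuffle ?B' ?C) v + append_letter (shuffle ?B ?C') w"
      unfolding ABC by (rule shuffle_append_letter)
    have 1: "shuffle (append_letter (shuffle ?A' ?B) u) ?C =
        append_letter (shuffle (shuffle ?A' ?B) ?C) u +
        append_letter (shuffle (append_letter (shuffle ?A' ?B) u) ?C') w"
      unfolding ABC by (rule shuffle_append_letter)
    have 2: "shuffle (append_letter (shuffle ?A ?B') v) ?C =
        append_letter (shuffle (shuffle ?A ?B') ?C) v +
        append_letter (shuffle (append_letter (shuffle ?A ?B') v) ?C') w"
      unfolding ABC by (rule shuffle_append_letter)
    have 3: "shuffle ?A (append_letter (shuffle ?B' ?C) v) =
        append_letter (shuffle ?A' (append_letter (shuffle ?B' ?C) v)) u +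
        append_letter (shuffle ?A (shuffle ?B' ?C)) v"
      unfolding ABC by (rule shuffle_append_letter)
    have 4: "shuffle ?A (append_letter (shuffle ?B ?C') w) =
        append_letter (shuffle ?A' (append_letter (shuffle ?B ?C') w)) u +
        append_letter (shuffle ?A (shuffle ?B ?C')) w"
      unfolding ABC by (rule shuffle_append_letter)
    have IH: "shuffle (shuffle ?A' ?B) ?C = shuffle ?A' (shuffle ?B ?C)"
      "shuffle (shuffle ?A ?B') ?C = shuffle ?A (shuffle ?B' ?C)"
      "shuffle (shuffle ?A ?B) ?C' = shuffle ?A (shuffle ?B ?C')"
      by (rule less.hyps; simp add: eq)+
    \<comment> \<open>The two parts ending in \<open>w\<close>, one from each summand of
      \<open>AB\<close>, recombine by \<open>AB\<close> read backwards into the product of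
      \<open>?A\<close>, \<open>?B\<close> and \<open>?C'\<close>.\<close>
    have "shuffle (shuffle ?A ?B) ?C =
        append_letter (shuffle (shuffle ?A' ?B) ?C) u +
        append_letter (shuffle (shuffle ?A ?B') ?C) v +
        append_letter (shuffle (shuffle ?A ?B) ?C') w"
      by (simp only: AB shuffle_add_left append_letter_add 1 2 ac_simps)
    moreover have "shuffle ?A (shuffle ?B ?C) =
        append_letter (shuffle ?A' (shuffle ?B ?C)) u +
        append_letter (shuffle ?A (shuffle ?B' ?C)) v +
        append_letter (shuffle ?A (shuffle ?B ?C')) w"
      by (simp only: BC shuffle_add_right append_letter_add 3 4 ac_simps)
    ultimately show ?thesis
      by (simp only: IH)
  qed
qed

lemma shuffle_assoc: "shuffle (shuffle p q) r = shuffle p (shuffle q r)"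
proof (induction p rule: ncpoly_induct)
  case (word a)
  show ?case
  proof (induction q rule: ncpoly_induct)
    case (word b)
    show ?case
      by (induction r rule: ncpoly_induct)
         (simp_all only: shuffle_linear shuffle_assoc_word)
  qed (simp_all only: shuffle_linear)
qed (simp_all only: shuffle_linear)

section \<open>The derivation deleting a final letter Y\<close>

text \<open>The index of the deleted letter is forgotten. Two words that differ only in the index of
  their final \<open>Y\<close> thus have the same image, which puts the differences among
  \<open>generators0\<close> into the kernel.\<close>

definition drop_Y :: "word \<Rightarrow> ncpoly" where
  "drop_Y w = (if w \<noteq> [] \<and> last w \<noteq> X then word_elem (butlast w) else 0)"

definition deriv_Y :: "ncpoly \<Rightarrow> ncpoly" where
  "deriv_Y = lin_ext drop_Y"

lemma drop_Y_simps [simp]: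
  "drop_Y [] = 0" "drop_Y (w @ [X]) = 0" "drop_Y (w @ [Y l]) = word_elem w"
  by (simp_all add: drop_Y_def)

lemma deriv_Y_word_elem [simp]: "deriv_Y (word_elem w) = drop_Y w"
  by (simp add: deriv_Y_def)

lemma deriv_Y_add: "deriv_Y (p + q) = deriv_Y p + deriv_Y q"
  by (simp add: deriv_Y_def lin_ext_add)

lemma deriv_Y_scale: "deriv_Y (scale c p) = scale c (deriv_Y p)"
  by (simp add: deriv_Y_def lin_ext_scale)

lemma deriv_Y_diff: "deriv_Y (p - q) = deriv_Y p - deriv_Y q"
  by (simp add: deriv_Y_def lin_ext_diff)

lemma deriv_Y_sum: "deriv_Y (sum f A) = (\<Sum>a\<in>A. deriv_Y (f a))"
  by (simp add: deriv_Y_def lin_ext_sum)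

lemma deriv_Y_append_letter:
  "deriv_Y (append_letter p u) = (if u = X then 0 else p)"
  by (cases u; induction p rule: ncpoly_induct)
     (simp_all add: append_letter_add append_letter_scale deriv_Y_add deriv_Y_scale)

text \<open>Each summand of the recursion ends in the last letter of \<open>u\<close> or in that of
  \<open>v\<close>, and deleting this letter leaves one Leibniz term. If the letter is
  \<open>X\<close>, the summand and the Leibniz term both vanish.\<close>

lemma deriv_Y_shuffle_word:
  "deriv_Y (shuffle_word u v) =
    shuffle (drop_Y u) (word_elem v) + shuffle (word_elem u) (drop_Y v)"
proof (cases u rule: rev_cases; cases v rule: rev_cases)
  fix u' a v' b assume "u = u' @ [a]" "v = v' @ [b]"
  then show ?thesis
    by (cases a; cases b)
       (simp_all add: deriv_Y_append_letter deriv_Y_add)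
qed simp_all

lemma deriv_Y_shuffle:
  "deriv_Y (shuffle p q) = shuffle (deriv_Y p) q + shuffle p (deriv_Y q)"
proof (induction p rule: ncpoly_induct)
  case (word w)
  show ?case
  proof (induction q rule: ncpoly_induct)
    case (word v)
    show ?case by (simp add: deriv_Y_shuffle_word)
  qed (simp_all add: shuffle_linear deriv_Y_add deriv_Y_scale scale_add_right algebra_simps)
qed (simp_all add: shuffle_linear deriv_Y_add deriv_Y_scale scale_add_right algebra_simps)

section \<open>Words with positive prefix weights\<close>

definition weight :: "word \<Rightarrow> rat" where
  "weight w = (\<Sum>a\<leftarrow>w. case a of X \<Rightarrow> 0 | Y l \<Rightarrow> l)"

text \<open>All prefixes are tested, not only those at block ends, so that deleting the last letter
  preserves the condition. Since \<open>X\<close> has weight 0, a prefix ending inside a run of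
  \<open>X\<close> adds no condition, while a leading \<open>X\<close> is excluded.\<close>

definition pos_word :: "word \<Rightarrow> bool" where
  "pos_word w \<longleftrightarrow> (\<forall>u v. w = u @ v \<longrightarrow> u \<noteq> [] \<longrightarrow> weight u > 0)"

lemma weight_simps [simp]:
  "weight [] = 0" "weight (u @ v) = weight u + weight v"
  "weight (X # w) = weight w" "weight (Y l # w) = l + weight w"
  "weight (replicate t X) = 0"
  by (simp_all add: weight_def sum_list_replicate)

lemma pos_word_Nil [simp]: "pos_word []"
  by (simp add: pos_word_def)

lemma pos_word_snoc: "pos_word (w @ [a]) \<longleftrightarrow> pos_word w \<and> weight (w @ [a]) > 0"
proof
  assume *: "pos_word (w @ [a])"
  have "weight u > 0" if "w = u @ v" "u \<noteq> []" for u v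
    using * that unfolding pos_word_def by (metis append.assoc)
  moreover have "weight (w @ [a]) > 0"
    using * unfolding pos_word_def by (metis append_Nil2 snoc_eq_iff_butlast)
  ultimately show "pos_word w \<and> weight (w @ [a]) > 0"
    by (simp add: pos_word_def)
next
  assume *: "pos_word w \<and> weight (w @ [a]) > 0"
  show "pos_word (w @ [a])"
    unfolding pos_word_def
  proof (intro allI impI)
    fix u v assume "w @ [a] = u @ v" "u \<noteq> []"
    with * show "weight u > 0"
      by (cases v rule: rev_cases) (auto simp: pos_word_def)
  qed
qed

lemma pos_word_append_replicate_X:
  "pos_word w \<Longrightarrow> weight w > 0 \<Longrightarrow> pos_word (w @ replicate t X)"
proof (induction t)
  case (Suc t)
  have "w @ replicate (Suc t) X = (w @ replicate t X) @ [X]"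
    by (simp add: replicate_append_same)
  then show ?case
    using Suc by (simp only: pos_word_snoc) simp
qed simp

lemma pos_word_append_block:
  "pos_word w \<Longrightarrow> weight w + l > 0 \<Longrightarrow> pos_word (w @ Y l # replicate t X)"
  using pos_word_append_replicate_X[of "w @ [Y l]" t] by (simp add: pos_word_snoc)

lemma keys_append_letter:
  "Poly_Mapping.keys (append_letter p a) \<subseteq> (\<lambda>w. w @ [a]) ` Poly_Mapping.keys p"
  unfolding append_letter_eq by (auto elim!: keys_lin_extE)

text \<open>The weight is carried along because positivity of the whole word rests on it: the weight
  is a sum of two positive ones when both words are nonempty. Proper prefixes are handled by
  induction.\<close>

lemma keys_shuffle_word:
  assumes "pos_word u" "pos_word v" "w \<in> Poly_Mapping.keys (shuffle_word u v)"
  shows "pos_word w \<and> weight w = weight u + weight v"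
  using assms
proof (induction u v arbitrary: w rule: shuffle_word.induct)
  case (3 w\<^sub>1 u w\<^sub>2 v)
  have pos: "pos_word w\<^sub>1" "pos_word w\<^sub>2" "weight (w\<^sub>1 @ [u]) > 0" "weight (w\<^sub>2 @ [v]) > 0"
    using 3(3,4) by (simp_all add: pos_word_snoc)
  consider
      w' where "w = w' @ [u]" "w' \<in> Poly_Mapping.keys (shuffle_word w\<^sub>1 (w\<^sub>2 @ [v]))"
    | w' where "w = w' @ [v]" "w' \<in> Poly_Mapping.keys (shuffle_word (w\<^sub>1 @ [u]) w\<^sub>2)"
    using subsetD[OF Poly_Mapping.keys_add 3(5)[unfolded shuffle_word.simps(3)]]
    by (auto dest!: subsetD[OF keys_append_letter])
  then show ?case
  proof cases
    case 1
    with 3(1)[OF pos(1) 3(4)] pos show ?thesis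
      by (auto simp: pos_word_snoc)
  next
    case 2
    with 3(2)[OF 3(3) pos(2)] pos show ?thesis
      by (auto simp: pos_word_snoc)
  qed
qed auto

section \<open>Positive words as block words and as words of bi-indices\<close>

lemma concat_blocks_pos_word:
  assumes "length ls = length ts" "\<forall>i\<in>{1..length ls}. sum_list (take i ls) > 0"
  shows "pos_word (concat (map (\<lambda>(l, t). Y l # replicate t X) (zip ls ts))) \<and>
    weight (concat (map (\<lambda>(l, t). Y l # replicate t X) (zip ls ts))) = sum_list ls"
  using assms
proof (induction ls arbitrary: ts rule: rev_induct)
  case (snoc l ls)
  obtain ts' t where ts: "ts = ts' @ [t]"
    using snoc.prems(1) by (cases ts rule: rev_cases) auto
  have "\<forall>i\<in>{1..length ls}. sum_list (take i ls) > 0"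
    using snoc.prems(2) by force
  moreover have "sum_list ls + l > 0"
    using snoc.prems(2) by (force dest: bspec[of _ _ "length (ls @ [l])"])
  ultimately show ?case
    using snoc.IH[of ts'] snoc.prems(1) ts by (simp add: pos_word_append_block)
qed simp

lemma pos_wordE_blocks:
  assumes "pos_word w"
  obtains ls ts where "length ls = length ts" "\<forall>i\<in>{1..length ls}. sum_list (take i ls) > 0"
    "w = concat (map (\<lambda>(l, t). Y l # replicate t X) (zip ls ts))"
proof -
  have "\<exists>ls ts. length ls = length ts \<and> (\<forall>i\<in>{1..length ls}. sum_list (take i ls) > 0) \<and>
    w = concat (map (\<lambda>(l, t). Y l # replicate t X) (zip ls ts))"
    using assms
  proof (induction w rule: rev_induct)
    case (snoc a w)
    then obtain ls ts where *: "length ls = length ts"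
      "\<forall>i\<in>{1..length ls}. sum_list (take i ls) > 0"
      "w = concat (map (\<lambda>(l, t). Y l # replicate t X) (zip ls ts))"
      by (auto simp: pos_word_snoc)
    have wt: "weight w = sum_list ls"
      using concat_blocks_pos_word *  by blast
    have pos: "weight (w @ [a]) > 0"
      using snoc.prems by (simp add: pos_word_snoc)
    show ?case
    proof (cases a)
      case X
      \<comment> \<open>Without a block the word would be a single \<open>X\<close>, of weight 0. So
        there is a last block whose run of \<open>X\<close> can be lengthened.\<close>
      then have "ts \<noteq> []"
        using pos wt * by auto
      then obtain ts' t where ts: "ts = ts' @ [t]"
        by (cases ts rule: rev_cases) auto
      obtain ls' l where ls: "ls = ls' @ [l]"
        using ts * by (cases ls rule: rev_cases) auto
      show ?thesis
        using * X ts ls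
        by (intro exI[of _ ls] exI[of _ "ts' @ [Suc t]"])
           (simp add: replicate_append_same del: replicate_Suc, simp flip: replicate_append_same)
    next
      case (Y l)
      have "sum_list (take i (ls @ [l])) > 0" if "i \<in> {1..length (ls @ [l])}" for i
        using that * pos wt Y by (cases "i = Suc (length ls)") auto
      then show ?thesis
        using * Y by (intro exI[of _ "ls @ [l]"] exI[of _ "ts @ [0]"]) auto
    qed
  qed (auto intro!: exI[of _ "[]"])
  then show ?thesis
    using that by blast
qed

lemma yx_word_Nil [simp]: "yx_word [] ms = []"
  by (simp add: yx_word_def)

lemma yx_word_snoc:
  assumes "length ks = length ms"
  shows "yx_word (ks @ [k]) (ms @ [m]) =
    yx_word ks ms @ Y (m - (if ms = [] then 0 else last ms)) # replicate (k - 1) X"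
proof -
  let ?f = "\<lambda>ks ms i. Y (ms ! i - (if i = 0 then 0 else ms ! (i - 1))) # replicate (ks ! i - 1) X"
  have "map (?f (ks @ [k]) (ms @ [m])) [0..<length ks] = map (?f ks ms) [0..<length ks]"
    using assms by (intro map_cong) (auto simp: nth_append)
  moreover have "?f (ks @ [k]) (ms @ [m]) (length ks) =
      Y (m - (if ms = [] then 0 else last ms)) # replicate (k - 1) X"
    using assms by (auto simp: nth_append last_conv_nth)
  moreover have "yx_word (ks @ [k]) (ms @ [m]) =
      concat (map (?f (ks @ [k]) (ms @ [m])) [0..<length ks]) @ ?f (ks @ [k]) (ms @ [m]) (length ks)"
    by (simp add: yx_word_def)
  ultimately show ?thesis
    by (simp only: yx_word_def)
qed

lemma positive_bi_index_snoc:
  "positive_bi_index (ks @ [k]) (ms @ [m]) \<longleftrightarrow> positive_bi_index ks ms \<and> k \<ge> 1 \<and> m > 0"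
  by (auto simp: positive_bi_index_def bi_index_def)

text \<open>The indices of the letters \<open>Y\<close> are consecutive differences of
  \<open>ms\<close>, so the prefix weights telescope to the entries of \<open>ms\<close>.\<close>

lemma yx_word_pos_word:
  assumes "positive_bi_index ks ms"
  shows "pos_word (yx_word ks ms) \<and> weight (yx_word ks ms) = (if ms = [] then 0 else last ms)"
  using assms
proof (induction ks arbitrary: ms rule: rev_induct)
  case Nil
  then show ?case
    by (simp add: positive_bi_index_def bi_index_def)
next
  case (snoc k ks)
  obtain ms' m where ms: "ms = ms' @ [m]"
    using snoc.prems by (cases ms rule: rev_cases) (auto simp: positive_bi_index_def bi_index_def)
  have *: "positive_bi_index ks ms'" "m > 0"
    using snoc.prems by (simp_all add: ms positive_bi_index_snoc)
  then have "length ks = length ms'"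
    by (simp add: positive_bi_index_def bi_index_def)
  with snoc.IH[OF *(1)] * show ?case
    by (simp add: ms yx_word_snoc pos_word_append_block)
qed

text \<open>The last entry of a bi-index is the total weight of its word. Changing it alone, when
  the last exponent is 1, therefore changes only the index of the final letter.\<close>

lemma yx_word_snoc_Y:
  assumes "positive_bi_index ks ms"
  shows "yx_word (ks @ [1]) (ms @ [m]) = yx_word ks ms @ [Y (m - weight (yx_word ks ms))]"
proof -
  have "length ks = length ms"
    using assms by (simp add: positive_bi_index_def bi_index_def)
  then show ?thesis
    using yx_word_pos_word[OF assms] by (simp add: yx_word_snoc)
qed

lemma yx_word_admissible:
  assumes "admissible_bi_index ks ms"
  obtains w where "yx_word ks ms = w @ [X]"
proof -
  obtain ks' k where ks: "ks = ks' @ [k]"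
    using assms by (cases ks rule: rev_cases) (auto simp: admissible_bi_index_def)
  obtain ms' m where ms: "ms = ms' @ [m]"
    using assms ks by (cases ms rule: rev_cases)
      (auto simp: admissible_bi_index_def positive_bi_index_def bi_index_def)
  have len: "length ks' = length ms'" and "k > 1"
    using assms by (auto simp: ks ms admissible_bi_index_def positive_bi_index_def bi_index_def)
  then obtain j where "k - 1 = Suc j"
    by (metis Suc_diff_Suc One_nat_def)
  then show ?thesis
    using that len by (simp add: ks ms yx_word_snoc flip: replicate_append_same)
qed

text \<open>The bi-index is read off the word: the entries of \<open>ms\<close> are the prefix
  weights at the block ends, and those of \<open>ks\<close> are one more than the lengths of the
  runs of \<open>X\<close>. A final \<open>X\<close> makes the last exponent exceed 1, hence the
  admissibility.\<close>

lemma pos_wordE_yx: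
  assumes "pos_word w"
  obtains ks ms where "positive_bi_index ks ms" "w = yx_word ks ms"
    "w \<noteq> [] \<Longrightarrow> last w = X \<Longrightarrow> admissible_bi_index ks ms"
proof -
  have "\<exists>ks ms. positive_bi_index ks ms \<and> w = yx_word ks ms \<and>
      (w \<noteq> [] \<longrightarrow> last w = X \<longrightarrow> admissible_bi_index ks ms)"
    using assms
  proof (induction w rule: rev_induct)
    case Nil
    show ?case
      by (intro exI[of _ "[]"]) (simp add: positive_bi_index_def bi_index_def)
  next
    case (snoc a w)
    then obtain ks ms where *: "positive_bi_index ks ms" "w = yx_word ks ms"
      by (auto simp: pos_word_snoc)
    have pos: "weight (w @ [a]) > 0"
      using snoc.prems by (simp add: pos_word_snoc)
    show ?case
    proof (cases a)
      case X
      then have "ks \<noteq> []"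
        using pos * by auto
      then obtain ks' k where ks: "ks = ks' @ [k]"
        by (cases ks rule: rev_cases) auto
      obtain ms' m where ms: "ms = ms' @ [m]"
        using ks * by (cases ms rule: rev_cases) (auto simp: positive_bi_index_def bi_index_def)
      have **: "positive_bi_index ks' ms'" "k \<ge> 1" "m > 0"
        using * by (auto simp: ks ms positive_bi_index_snoc)
      then have len: "length ks' = length ms'"
        by (simp add: positive_bi_index_def bi_index_def)
      \<comment> \<open>The subtraction in \<open>yx_word\<close> is truncated; it is
        \<open>k \<ge> 1\<close> that lets a larger exponent lengthen the run of
        \<open>X\<close>.\<close>
      have "replicate (Suc k - 1) X = replicate (k - 1) X @ [X]"
        using \<open>k \<ge> 1\<close> by (cases k) (simp_all add: replicate_append_same)
      then have "w @ [a] = yx_word (ks' @ [Suc k]) ms"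
        using len * by (simp add: X ks ms yx_word_snoc)
      moreover have "positive_bi_index (ks' @ [Suc k]) ms"
        using ** by (simp add: ms positive_bi_index_snoc)
      moreover from this have "admissible_bi_index (ks' @ [Suc k]) ms"
        using ** by (simp add: admissible_bi_index_def)
      ultimately show ?thesis
        by blast
    next
      case (Y l)
      have "w @ [a] = yx_word (ks @ [1]) (ms @ [weight (w @ [a])])"
        using yx_word_snoc_Y[OF *(1)] * by (simp add: Y)
      moreover have "positive_bi_index (ks @ [1]) (ms @ [weight (w @ [a])])"
        using * pos by (simp add: positive_bi_index_snoc)
      moreover have "last (w @ [a]) \<noteq> X"
        by (simp add: Y)
      ultimately show ?thesis
        by blast
    qed
  qed
  then show ?thesis
    using that by blast
qed

section \<open>The two modules as kernel and domain of the derivation\<close>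

lemma span_over_zero: "0 \<in> span_over R S"
  unfolding span_over_def by (intro CollectI exI[of _ "{}"]) auto

text \<open>Abstracts from \<open>Q_adjoin\<close>. The rationals supply the coefficient -1 for
  differences and the factors 1/(j+1) for integration.\<close>

locale rat_subalgebra =
  fixes R :: "complex set"
  assumes of_rat_mem: "of_rat q \<in> R"
    and add_mem: "a \<in> R \<Longrightarrow> b \<in> R \<Longrightarrow> a + b \<in> R"
    and mult_mem: "a \<in> R \<Longrightarrow> b \<in> R \<Longrightarrow> a * b \<in> R"
begin

lemma zero_mem [simp]: "0 \<in> R"
  using of_rat_mem[of 0] by simp

lemma one_mem [simp]: "1 \<in> R"
  using of_rat_mem[of 1] by simp

lemma minus_one_mem [simp]: "- 1 \<in> R"
  using of_rat_mem[of "- 1"] by (simp add: of_rat_minus)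

lemma sum_mem: "(\<And>i. i \<in> A \<Longrightarrow> f i \<in> R) \<Longrightarrow> sum f A \<in> R"
  by (induction A rule: infinite_finite_induct) (auto intro: add_mem)

lemma span_over_base: "s \<in> S \<Longrightarrow> s \<in> span_over R S"
  unfolding span_over_def by (intro CollectI exI[of _ "{s}"] exI[of _ "\<lambda>_. 1"]) auto

lemma span_over_scale:
  assumes "c \<in> R" "p \<in> span_over R S"
  shows "scale c p \<in> span_over R S"
proof -
  obtain F d where *: "p = (\<Sum>s\<in>F. scale (d s) s)" "finite F" "F \<subseteq> S" "\<forall>s\<in>F. d s \<in> R"
    using assms(2) unfolding span_over_def by blast
  then show ?thesis
    unfolding span_over_def
    by (intro CollectI exI[of _ F] exI[of _ "\<lambda>s. c * d s"]) (auto simp: scale_sum intro: mult_mem assms)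
qed

lemma span_over_add:
  assumes "p \<in> span_over R S" "q \<in> span_over R S"
  shows "p + q \<in> span_over R S"
proof -
  obtain F c where F: "p = (\<Sum>s\<in>F. scale (c s) s)" "finite F" "F \<subseteq> S" "\<forall>s\<in>F. c s \<in> R"
    using assms(1) unfolding span_over_def by blast
  obtain G d where G: "q = (\<Sum>s\<in>G. scale (d s) s)" "finite G" "G \<subseteq> S" "\<forall>s\<in>G. d s \<in> R"
    using assms(2) unfolding span_over_def by blast
  let ?c = "\<lambda>s. if s \<in> F then c s else 0" and ?d = "\<lambda>s. if s \<in> G then d s else 0"
  have "p = (\<Sum>s\<in>F \<union> G. scale (?c s) s)"
    unfolding F(1) using F G by (intro sum.mono_neutral_cong_left) auto
  moreover have "q = (\<Sum>s\<in>F \<union> G. scale (?d s) s)"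
    unfolding G(1) using F G by (intro sum.mono_neutral_cong_left) auto
  ultimately have "p + q = (\<Sum>s\<in>F \<union> G. scale (?c s + ?d s) s)"
    by (simp only: scale_add_left sum.distrib)
  then show ?thesis
    unfolding span_over_def using F G
    by (intro CollectI exI[of _ "F \<union> G"] exI[of _ "\<lambda>s. ?c s + ?d s"])
       (auto intro!: add_mem)
qed

text \<open>Serves to place \<open>p\<close> in a span: it suffices to write \<open>p\<close> as
  \<open>lin_ext f p\<close> with \<open>f\<close> sending each word of the support into the
  span.\<close>

lemma span_over_lin_ext:
  assumes "\<And>w. Poly_Mapping.lookup p w \<in> R"
    and "\<And>w. w \<in> Poly_Mapping.keys p \<Longrightarrow> f w \<in> span_over R S"
  shows "lin_ext f p \<in> span_over R S"
proof -
  have "(\<Sum>w\<in>A. scale (Poly_Mapping.lookup p w) (f w)) \<in> span_over R S"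
    if "A \<subseteq> Poly_Mapping.keys p" for A
    using finite_subset[OF that finite_keys] that
    by (induction A rule: finite_induct)
       (simp_all add: span_over_zero span_over_add span_over_scale assms)
  then show ?thesis
    by (simp add: lin_ext_def)
qed

lemma span_over_subset:
  assumes "S \<subseteq> N" "0 \<in> N" "\<And>p q. p \<in> N \<Longrightarrow> q \<in> N \<Longrightarrow> p + q \<in> N"
    and "\<And>c p. c \<in> R \<Longrightarrow> p \<in> N \<Longrightarrow> scale c p \<in> N"
  shows "span_over R S \<subseteq> N"
proof
  fix p assume "p \<in> span_over R S"
  then obtain F c where F: "p = (\<Sum>s\<in>F. scale (c s) s)" "finite F" "F \<subseteq> S" "\<forall>s\<in>F. c s \<in> R"
    unfolding span_over_def by blast
  from F(2-4) have "(\<Sum>s\<in>F. scale (c s) s) \<in> N"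
  proof (induction F rule: finite_induct)
    case (insert s F)
    then show ?case
      using assms(1) by (auto intro!: assms(3,4))
  qed (simp add: assms(2))
  then show "p \<in> N"
    using F(1) by simp
qed

text \<open>The ambient module has complex coefficients, so membership of the coefficients in
  \<open>R\<close> is stated beside the condition on the support. Both are tested word by
  word.\<close>

definition pos_module :: "ncpoly set" where
  "pos_module = {p. (\<forall>w. Poly_Mapping.lookup p w \<in> R) \<and> (\<forall>w\<in>Poly_Mapping.keys p. pos_word w)}"

definition pos_kernel :: "ncpoly set" where
  "pos_kernel = {p \<in> pos_module. deriv_Y p = 0}"

lemma pos_module_zero: "0 \<in> pos_module"
  by (simp add: pos_module_def)

lemma pos_module_add: "p \<in> pos_module \<Longrightarrow> q \<in> pos_module \<Longrightarrow> p + q \<in> pos_module"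
  using Poly_Mapping.keys_add[of p q] by (auto simp: pos_module_def lookup_add intro: add_mem)

lemma pos_module_scale: "c \<in> R \<Longrightarrow> p \<in> pos_module \<Longrightarrow> scale c p \<in> pos_module"
  by (auto simp: pos_module_def in_keys_iff intro: mult_mem)

lemma pos_module_diff: "p \<in> pos_module \<Longrightarrow> q \<in> pos_module \<Longrightarrow> p - q \<in> pos_module"
  using pos_module_add[of p "scale (- 1) q"] pos_module_scale[of "- 1" q]
  by (simp add: scale_minus_1)

lemma pos_module_sum: "(\<And>i. i \<in> A \<Longrightarrow> f i \<in> pos_module) \<Longrightarrow> sum f A \<in> pos_module"
  by (induction A rule: infinite_finite_induct) (auto intro: pos_module_add pos_module_zero)

lemma pos_module_word_elem: "pos_word w \<Longrightarrow> word_elem w \<in> pos_module"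
  by (auto simp: pos_module_def lookup_single when_def)

lemma pos_module_lin_ext:
  assumes "p \<in> pos_module" "\<And>w. pos_word w \<Longrightarrow> f w \<in> pos_module"
  shows "lin_ext f p \<in> pos_module"
  unfolding lin_ext_def using assms
  by (intro pos_module_sum pos_module_scale) (auto simp: pos_module_def)

lemma lookup_append_letter_mem:
  assumes "\<And>w. Poly_Mapping.lookup p w \<in> R"
  shows "Poly_Mapping.lookup (append_letter p a) w \<in> R"
  unfolding append_letter_eq lookup_lin_ext
  by (intro sum_mem mult_mem assms) (simp add: lookup_single when_def)

lemma lookup_shuffle_word_mem: "Poly_Mapping.lookup (shuffle_word u v) w \<in> R"
  by (induction u v arbitrary: w rule: shuffle_word.induct)
     (simp_all add: lookup_single when_def lookup_add add_mem lookup_append_letter_mem)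

lemma pos_module_shuffle:
  assumes "p \<in> pos_module" "q \<in> pos_module"
  shows "shuffle p q \<in> pos_module"
proof -
  have "shuffle_word u v \<in> pos_module" if "pos_word u" "pos_word v" for u v
    using keys_shuffle_word[OF that] by (simp add: pos_module_def lookup_shuffle_word_mem)
  then show ?thesis
    unfolding shuffle_eq by (intro pos_module_lin_ext assms)
qed

lemma pos_module_deriv_Y:
  assumes "p \<in> pos_module"
  shows "deriv_Y p \<in> pos_module"
  unfolding deriv_Y_def
proof (rule pos_module_lin_ext[OF assms])
  fix w assume "pos_word w"
  then show "drop_Y w \<in> pos_module"
    by (cases w rule: rev_cases)
       (auto simp: drop_Y_def pos_word_snoc pos_module_zero intro: pos_module_word_elem)
qed

lemma pos_kernel_zero: "0 \<in> pos_kernel"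
  by (simp add: pos_kernel_def pos_module_zero deriv_Y_def)

lemma pos_kernel_add: "p \<in> pos_kernel \<Longrightarrow> q \<in> pos_kernel \<Longrightarrow> p + q \<in> pos_kernel"
  by (simp add: pos_kernel_def pos_module_add deriv_Y_add)

lemma pos_kernel_scale: "c \<in> R \<Longrightarrow> p \<in> pos_kernel \<Longrightarrow> scale c p \<in> pos_kernel"
  by (simp add: pos_kernel_def pos_module_scale deriv_Y_scale)

lemma pos_kernel_shuffle: "p \<in> pos_kernel \<Longrightarrow> q \<in> pos_kernel \<Longrightarrow> shuffle p q \<in> pos_kernel"
  by (simp add: pos_kernel_def pos_module_shuffle deriv_Y_shuffle)

lemma pos_kernel_one: "word_elem [] \<in> pos_kernel"
  by (simp add: pos_kernel_def pos_module_word_elem)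

section \<open>Identification of the two spans\<close>

lemma span_generators1: "span_over R generators1 = pos_module"
proof
  show "span_over R generators1 \<subseteq> pos_module"
  proof (rule span_over_subset)
    show "generators1 \<subseteq> pos_module"
      using concat_blocks_pos_word by (auto simp: generators1_def intro!: pos_module_word_elem)
  qed (auto intro: pos_module_zero pos_module_add pos_module_scale)
  show "pos_module \<subseteq> span_over R generators1"
  proof
    fix p assume p: "p \<in> pos_module"
    have "word_elem w \<in> generators1" if "pos_word w" for w
      using pos_wordE_blocks[OF that] unfolding generators1_def by blast
    then have "lin_ext word_elem p \<in> span_over R generators1"
      using p by (intro span_over_lin_ext span_over_base) (auto simp: pos_module_def)
    then show "p \<in> span_over R generators1"
      by simp
  qed
qed

text \<open>The word of an admissible bi-index ends in \<open>X\<close> and is killed. The two words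
  of a difference become equal once their final \<open>Y\<close> is deleted.\<close>

lemma generators0_subset_pos_kernel: "generators0 \<subseteq> pos_kernel"
proof
  fix p assume "p \<in> generators0"
  then consider "p = word_elem []"
    | ks ms where "p = word_elem (yx_word ks ms)" "admissible_bi_index ks ms"
    | ks ms m m' where
        "p = word_elem (yx_word (ks @ [1]) (ms @ [m])) - word_elem (yx_word (ks @ [1]) (ms @ [m']))"
        "positive_bi_index (ks @ [1]) (ms @ [m])" "positive_bi_index (ks @ [1]) (ms @ [m'])"
    unfolding generators0_def by blast
  then show "p \<in> pos_kernel"
  proof cases
    case 1
    then show ?thesis by (simp add: pos_kernel_one)
  next
    case 2
    then obtain w where "yx_word ks ms = w @ [X]"
      using yx_word_admissible by blast
    moreover have "pos_word (yx_word ks ms)"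
      using yx_word_pos_word 2(2) by (simp add: admissible_bi_index_def)
    ultimately show ?thesis
      by (simp add: 2(1) pos_kernel_def pos_module_word_elem)
  next
    case 3
    have "deriv_Y p = 0"
      using 3 unfolding positive_bi_index_snoc by (simp add: yx_word_snoc_Y deriv_Y_diff flip: One_nat_def)
    then show ?thesis
      using 3 yx_word_pos_word by (simp add: pos_kernel_def pos_module_diff pos_module_word_elem)
  qed
qed

lemma diff_mem_span_generators0:
  assumes "pos_word (v @ [Y a])" "pos_word (v @ [Y b])"
  shows "word_elem (v @ [Y a]) - word_elem (v @ [Y b]) \<in> span_over R generators0"
proof (cases "a = b")
  case True
  then show ?thesis by (simp add: span_over_zero)
next
  case False
  have v: "pos_word v" and pos: "weight v + a > 0" "weight v + b > 0"
    using assms by (simp_all add: pos_word_snoc)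
  obtain ks ms where *: "positive_bi_index ks ms" "v = yx_word ks ms"
    using pos_wordE_yx[OF v] by blast
  \<comment> \<open>The last entry of the bi-index has to be the total weight, hence
    \<open>weight v + a\<close> rather than \<open>a\<close>.\<close>
  have "v @ [Y a] = yx_word (ks @ [1]) (ms @ [weight v + a])"
    "v @ [Y b] = yx_word (ks @ [1]) (ms @ [weight v + b])"
    using yx_word_snoc_Y[OF *(1)] * by simp_all
  moreover have "positive_bi_index (ks @ [1]) (ms @ [weight v + a])"
    "positive_bi_index (ks @ [1]) (ms @ [weight v + b])"
    using * pos by (simp_all add: positive_bi_index_snoc)
  moreover have "weight v + b \<noteq> weight v + a"
    using False by simp
  ultimately have "word_elem (v @ [Y a]) - word_elem (v @ [Y b]) \<in> generators0"
    unfolding generators0_def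
    by (intro UnI2 CollectI exI[of _ ks] exI[of _ ms] exI[of _ "weight v + a"]
        exI[of _ "weight v + b"]) (simp only: simp_thms)
  then show ?thesis
    by (rule span_over_base)
qed

lemma span_generators0: "span_over R generators0 = pos_kernel"
proof
  show "span_over R generators0 \<subseteq> pos_kernel"
    using generators0_subset_pos_kernel
    by (rule span_over_subset) (auto intro: pos_kernel_zero pos_kernel_add pos_kernel_scale)
  show "pos_kernel \<subseteq> span_over R generators0"
  proof
    fix p assume p: "p \<in> pos_kernel"
    define E where "E v = word_elem (v @ [Y (1 - weight v)])" for v
    \<comment> \<open>\<open>E\<close> is a section of \<open>drop_Y\<close>, so subtracting \<open>E \<circ> drop_Y\<close> does not change \<open>p\<close>,
      while it turns every word into a generator.\<close>
    have "lin_ext (\<lambda>w. word_elem w - lin_ext E (drop_Y w)) p = p - lin_ext E (deriv_Y p)"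
      by (simp add: lin_ext_diff_fun deriv_Y_def lin_ext_lin_ext)
    also have "\<dots> = p"
      using p by (simp add: pos_kernel_def)
    finally have eq: "lin_ext (\<lambda>w. word_elem w - lin_ext E (drop_Y w)) p = p" .
    have "word_elem w - lin_ext E (drop_Y w) \<in> span_over R generators0" if w: "pos_word w" for w
    proof (cases w rule: rev_cases)
      case Nil
      then show ?thesis
        by (auto simp: generators0_def intro: span_over_base)
    next
      case (snoc v a)
      show ?thesis
      proof (cases a)
        case X
        then obtain ks ms where "w = yx_word ks ms" "admissible_bi_index ks ms"
          using pos_wordE_yx[OF w] snoc by (metis last_snoc snoc_eq_iff_butlast)
        then have "word_elem w \<in> generators0"
          unfolding generators0_def by (intro UnI1 UnI2) blast
        then show ?thesis
          using snoc X by (simp add: span_over_base)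
      next
        case (Y l)
        \<comment> \<open>The index \<open>1 - weight v\<close> gives the reference word total
          weight 1, so it is positive whenever \<open>v\<close> is.\<close>
        then show ?thesis
          using snoc w diff_mem_span_generators0[of v l "1 - weight v"]
          by (simp add: E_def pos_word_snoc)
      qed
    qed
    then have "lin_ext (\<lambda>w. word_elem w - lin_ext E (drop_Y w)) p \<in> span_over R generators0"
      using p by (intro span_over_lin_ext) (auto simp: pos_kernel_def pos_module_def)
    then show "p \<in> span_over R generators0"
      by (simp only: eq)
  qed
qed

end

section \<open>Expansion in powers of a slice\<close>

text \<open>Powers independent of a carrier, so that the same element serves in both algebras. The
  new factor stands on the right, as in the powers of HOL-Algebra.\<close>

primrec shuffle_pow :: "ncpoly \<Rightarrow> nat \<Rightarrow> ncpoly" where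
  "shuffle_pow s 0 = word_elem []"
| "shuffle_pow s (Suc n) = shuffle (shuffle_pow s n) s"

lemma deriv_Y_shuffle_pow:
  assumes "deriv_Y s = word_elem []"
  shows "deriv_Y (shuffle_pow s (Suc n)) = scale (of_nat (Suc n)) (shuffle_pow s n)"
proof (induction n)
  case (Suc n)
  have "deriv_Y (shuffle_pow s (Suc (Suc n))) =
      scale (of_nat (Suc n)) (shuffle_pow s (Suc n)) + scale 1 (shuffle_pow s (Suc n))"
    unfolding shuffle_pow.simps(2)[of s "Suc n"] deriv_Y_shuffle Suc.IH assms
    by (simp add: shuffle_scale_left)
  also have "\<dots> = scale (of_nat (Suc n) + 1) (shuffle_pow s (Suc n))"
    by (simp only: scale_add_left)
  finally show ?case
    by (simp only: of_nat_Suc[of "Suc n"] add.commute)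
qed (simp add: assms deriv_Y_shuffle)

lemma deriv_Y_shuffle_shuffle_pow:
  assumes "deriv_Y s = word_elem []" "deriv_Y a = 0"
  shows "deriv_Y (shuffle a (shuffle_pow s (Suc n))) =
    shuffle (scale (of_nat (Suc n)) a) (shuffle_pow s n)"
  by (simp only: deriv_Y_shuffle deriv_Y_shuffle_pow[OF assms(1)] assms(2))
     (simp add: shuffle_scale_left shuffle_scale_right)

text \<open>On polynomials in \<open>s\<close> over the kernel the derivation acts as formal
  differentiation: the constant term drops out and the coefficients move down by one place.\<close>

lemma deriv_Y_power_expansion:
  assumes "deriv_Y s = word_elem []" "\<And>i. deriv_Y (a i) = 0"
  shows "deriv_Y (\<Sum>i<Suc n. shuffle (a i) (shuffle_pow s i)) =
    (\<Sum>i<n. shuffle (scale (of_nat (Suc i)) (a (Suc i))) (shuffle_pow s i))"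
  unfolding sum.lessThan_Suc_shift
  by (simp only: deriv_Y_add deriv_Y_sum deriv_Y_shuffle_shuffle_pow[OF assms])
     (simp add: assms)

text \<open>Differentiation turns a relation with \<open>Suc n\<close> terms into one with
  \<open>n\<close> terms, whose coefficients vanish by induction.\<close>

lemma power_expansion_unique:
  assumes "deriv_Y s = word_elem []" "\<And>i. deriv_Y (a i) = 0"
    and "(\<Sum>i<n. shuffle (a i) (shuffle_pow s i)) = 0" "i < n"
  shows "a i = 0"
  using assms(2-4)
proof (induction n arbitrary: a i)
  case (Suc n)
  let ?b = "\<lambda>i. scale (of_nat (Suc i)) (a (Suc i))"
  have "(\<Sum>i<n. shuffle (?b i) (shuffle_pow s i)) = deriv_Y (\<Sum>i<Suc n. shuffle (a i) (shuffle_pow s i))"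
    by (rule deriv_Y_power_expansion[OF assms(1) Suc.prems(1), symmetric])
  also have "\<dots> = 0"
    by (simp only: Suc.prems(2)) (simp add: deriv_Y_def)
  finally have sum_b: "(\<Sum>i<n. shuffle (?b i) (shuffle_pow s i)) = 0" .
  have b: "?b j = 0" if "j < n" for j
    by (rule Suc.IH[of ?b, OF _ sum_b that]) (simp only: deriv_Y_scale Suc.prems(1) scale_zero)
  have a: "a (Suc j) = 0" if "j < n" for j
  proof -
    have "scale (inverse (of_nat (Suc j))) (?b j) = 0"
      by (simp only: b[OF that] scale_zero)
    then show ?thesis
      by (simp del: of_nat_Suc)
  qed
  \<comment> \<open>With the higher coefficients gone, the relation reduces to \<open>a 0\<close>
    times the empty word, the unit.\<close>
  moreover have "a 0 = 0"
    using Suc.prems(2) unfolding sum.lessThan_Suc_shift by (simp add: a)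
  ultimately show ?case
    using Suc.prems(3) by (cases i) auto
qed simp

text \<open>The strict length bound \<open>n\<close> measures nilpotence: the derivation shortens
  every surviving word by one letter, and \<open>n = 0\<close> forces \<open>p = 0\<close>. An
  antiderivative of the expansion of \<open>deriv_Y p\<close> differs from \<open>p\<close> by a
  kernel element, which becomes the constant term.\<close>

lemma (in rat_subalgebra) power_expansion_exists:
  assumes "deriv_Y s = word_elem []" "s \<in> pos_module"
    and "p \<in> pos_module" "\<And>w. w \<in> Poly_Mapping.keys p \<Longrightarrow> length w < n"
  shows "\<exists>a. (\<forall>i. a i \<in> pos_kernel) \<and> p = (\<Sum>i<n. shuffle (a i) (shuffle_pow s i))"
  using assms(3,4)
proof (induction n arbitrary: p)
  case 0
  then have "p = 0"
    by (auto simp flip: keys_eq_empty)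
  then show ?case
    by (auto intro!: exI[of _ "\<lambda>_. 0"] pos_kernel_zero)
next
  case (Suc n)
  have "length w < n" if w: "w \<in> Poly_Mapping.keys (deriv_Y p)" for w
  proof -
    obtain v where "v \<in> Poly_Mapping.keys p" "w \<in> Poly_Mapping.keys (drop_Y v)"
      using keys_lin_extE[OF w[unfolded deriv_Y_def]] by blast
    then show ?thesis
      using Suc.prems(2)[of v] by (cases v rule: rev_cases) (auto simp: drop_Y_def split: if_splits)
  qed
  then obtain b where b: "\<And>i. b i \<in> pos_kernel"
    "deriv_Y p = (\<Sum>i<n. shuffle (b i) (shuffle_pow s i))"
    using Suc.IH[OF pos_module_deriv_Y[OF Suc.prems(1)]] by blast
  \<comment> \<open>Term-by-term antiderivative with constant term 0. Writing the factor 1/(j+1)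
    through \<open>of_rat\<close> makes its membership in \<open>R\<close> visible.\<close>
  define a where "a i = (case i of 0 \<Rightarrow> 0 | Suc j \<Rightarrow> scale (of_rat (inverse (of_nat (Suc j)))) (b j))" for i
  have a: "a i \<in> pos_kernel" for i
    by (auto simp: a_def intro!: pos_kernel_zero pos_kernel_scale of_rat_mem b split: nat.split)
  have ab: "scale (of_nat (Suc i)) (a (Suc i)) = b i" for i
    by (simp add: a_def of_rat_inverse del: of_nat_Suc)
  let ?q = "\<Sum>i<Suc n. shuffle (a i) (shuffle_pow s i)"
  have pow: "shuffle_pow s i \<in> pos_module" for i
    by (induction i) (simp_all add: pos_module_word_elem pos_module_shuffle assms(2))
  have "?q \<in> pos_module"
    using a pow by (intro pos_module_sum pos_module_shuffle) (auto simp: pos_kernel_def)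
  moreover have "deriv_Y ?q = deriv_Y p"
    using a unfolding b(2) ab[symmetric]
    by (intro deriv_Y_power_expansion assms(1)) (simp add: pos_kernel_def)
  ultimately have "p - ?q \<in> pos_kernel"
    using Suc.prems(1) by (simp add: pos_kernel_def pos_module_diff deriv_Y_diff del: sum.lessThan_Suc)
  \<comment> \<open>Since \<open>a 0\<close> is 0, overwriting it by the kernel element
    \<open>p - ?q\<close> adds exactly the missing part to \<open>?q\<close>.\<close>
  moreover have "p = (\<Sum>i<Suc n. shuffle ((a(0 := p - ?q)) i) (shuffle_pow s i))"
    unfolding sum.lessThan_Suc_shift by (simp add: a_def[of 0])
  ultimately show ?case
    using a by (intro exI[of _ "a(0 := p - ?q)"]) simp
qed

section \<open>The isomorphism\<close>

lemma map_poly_of_rat_add: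
  "map_poly of_rat (p + q) = (map_poly of_rat p + map_poly of_rat q :: complex poly)"
  by (rule poly_eqI) (simp add: coeff_map_poly of_rat_add)

lemma map_poly_of_rat_mult:
  "map_poly of_rat (p * q) = (map_poly of_rat p * map_poly of_rat q :: complex poly)"
  by (rule poly_eqI) (simp add: coeff_map_poly coeff_mult of_rat_sum of_rat_mult)

lemma rat_subalgebra_Q_adjoin: "rat_subalgebra (Q_adjoin \<mu>)"
proof
  show "of_rat q \<in> Q_adjoin \<mu>" for q
    unfolding Q_adjoin_def by (rule range_eqI[of _ _ "[:q:]"]) (simp add: map_poly_pCons)
  fix a b assume "a \<in> Q_adjoin \<mu>" "b \<in> Q_adjoin \<mu>"
  then obtain p q where ab: "a = poly (map_poly of_rat p) \<mu>" "b = poly (map_poly of_rat q) \<mu>"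
    unfolding Q_adjoin_def by auto
  show "a + b \<in> Q_adjoin \<mu>"
    unfolding Q_adjoin_def ab by (rule range_eqI[of _ _ "p + q"]) (simp add: map_poly_of_rat_add)
  show "a * b \<in> Q_adjoin \<mu>"
    unfolding Q_adjoin_def ab by (rule range_eqI[of _ _ "p * q"]) (simp add: map_poly_of_rat_mult)
qed

lemma shuffle_algebra_simps [simp]:
  "carrier (shuffle_algebra S) = S"
  "x \<otimes>\<^bsub>shuffle_algebra S\<^esub> y = shuffle x y"
  "x \<oplus>\<^bsub>shuffle_algebra S\<^esub> y = x + y"
  "x \<odot>\<^bsub>shuffle_algebra S\<^esub> y = shuffle x y"
  "\<one>\<^bsub>shuffle_algebra S\<^esub> = word_elem []"
  "\<zero>\<^bsub>shuffle_algebra S\<^esub> = 0"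
  by (simp_all add: shuffle_algebra_def)

lemma cring_shuffle_algebra:
  assumes "0 \<in> S" "word_elem [] \<in> S"
    and "\<And>x y. x \<in> S \<Longrightarrow> y \<in> S \<Longrightarrow> x + y \<in> S" "\<And>x. x \<in> S \<Longrightarrow> - x \<in> S"
    and "\<And>x y. x \<in> S \<Longrightarrow> y \<in> S \<Longrightarrow> shuffle x y \<in> S"
  shows "cring (shuffle_algebra S)"
proof (rule cringI)
  show "abelian_group (shuffle_algebra S)"
  proof (rule abelian_groupI)
    show "\<exists>y\<in>carrier (shuffle_algebra S). y \<oplus>\<^bsub>shuffle_algebra S\<^esub> x = \<zero>\<^bsub>shuffle_algebra S\<^esub>"
      if "x \<in> carrier (shuffle_algebra S)" for x
      using that assms(4)[of x] by (intro bexI[of _ "- x"]) simp_all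
  qed (simp_all add: assms add_ac)
  show "comm_monoid (shuffle_algebra S)"
    by (rule comm_monoidI) (simp_all add: assms shuffle_assoc, rule shuffle_commute)
qed (simp add: shuffle_add_left)

lemma nat_pow_shuffle_algebra: "s [^]\<^bsub>shuffle_algebra S\<^esub> (n :: nat) = shuffle_pow s n"
  by (induction n) (simp_all add: nat_pow_def)

text \<open>Links the sum in \<open>psi\<close> with the carrier-based sum by which evaluation of
  polynomials is defined.\<close>

lemma finsum_shuffle_algebra:
  assumes "cring (shuffle_algebra S)" "finite A" "f \<in> A \<rightarrow> S"
  shows "finsum (shuffle_algebra S) f A = sum f A"
proof -
  interpret cring "shuffle_algebra S" by fact
  show ?thesis
    using assms(2,3) by (induction A rule: finite_induct) (simp_all add: Pi_def)
qed

theorem theorem4p11: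
  fixes \<mu> :: complex and m :: rat
  assumes "Re \<mu> > 0" and "m > 0"
  shows "algebra_iso (algebra0 \<mu>) (UP (algebra0 \<mu>)) (algebra1 \<mu>) (psi \<mu> m)"
proof -
  interpret rat_subalgebra "Q_adjoin \<mu>" by (rule rat_subalgebra_Q_adjoin)
  have A0: "algebra0 \<mu> = shuffle_algebra pos_kernel"
    by (simp add: algebra0_def span_generators0)
  have A1: "algebra1 \<mu> = shuffle_algebra pos_module"
    by (simp add: algebra1_def span_generators1)
  have sub: "p \<in> pos_module" if "p \<in> pos_kernel" for p
    using that by (simp add: pos_kernel_def)
  have cring0: "cring (shuffle_algebra pos_kernel)"
    by (rule cring_shuffle_algebra)
       (auto intro: pos_kernel_zero pos_kernel_one pos_kernel_add pos_kernel_shuffle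
          pos_kernel_scale[of "- 1", simplified scale_minus_1])
  have cring1: "cring (shuffle_algebra pos_module)"
    by (rule cring_shuffle_algebra)
       (auto intro: pos_module_zero sub pos_kernel_one pos_module_add pos_module_shuffle
          pos_module_scale[of "- 1", simplified scale_minus_1])
  \<comment> \<open>The inclusion of the kernel is the coefficient map along which polynomials are
    evaluated at the slice. The universal property then yields a ring homomorphism.\<close>
  have id_hom: "id \<in> ring_hom (shuffle_algebra pos_kernel) (shuffle_algebra pos_module)"
    by (rule ring_hom_memI) (simp_all add: sub)
  define R where "R = shuffle_algebra pos_kernel"
  define S where "S = shuffle_algebra pos_module"
  define P where "P = UP R"
  define s :: ncpoly where "s = word_elem [Y m]"
  interpret UP_pre_univ_prop R S id P
    unfolding R_def S_def P_def
    by (intro UP_pre_univ_prop.intro UnivPoly.ring_hom_cringI cring0 cring1 id_hom UP_cring.intro) simp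
  have "pos_word [Y m]"
    using pos_word_snoc[of "[]" "Y m"] assms(2) by simp
  then have s: "s \<in> pos_module" "deriv_Y s = word_elem []"
    using drop_Y_simps(3)[of "[]" m] by (simp_all add: s_def pos_module_word_elem)
  have zero_S: "\<zero>\<^bsub>S\<^esub> = 0"
    by (simp add: S_def)
  have sS: "s \<in> carrier S"
    using s by (simp add: S_def)
  interpret UP_univ_prop R S id P s "eval R S id s"
    by (intro UP_univ_prop.intro UP_univ_prop_axioms.intro UP_pre_univ_prop_axioms sS) (simp_all add: P_def)
  have coeff: "up_ring.coeff P p i \<in> pos_kernel" if "p \<in> carrier P" for p i
    using coeff_closed[OF that] by (simp add: R_def)
  have pow: "shuffle_pow s i \<in> pos_module" for i
    by (induction i) (simp_all add: pos_module_word_elem pos_module_shuffle s)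
  have psi_sum: "psi \<mu> m p = (\<Sum>i\<le>deg R p. shuffle (up_ring.coeff P p i) (shuffle_pow s i))" for p
    by (simp add: psi_def A0 A1 nat_pow_shuffle_algebra R_def P_def s_def)
  have psi_eval: "psi \<mu> m p = eval R S id s p" if p: "p \<in> carrier P" for p
    unfolding eval_on_carrier[OF p] psi_sum S_def
    using coeff[OF p] pow
    by (subst finsum_shuffle_algebra[OF cring1])
       (auto simp: nat_pow_shuffle_algebra intro: pos_module_shuffle sub)
  have hom: "psi \<mu> m \<in> ring_hom P S"
  proof (rule ring_hom_memI)
    show "psi \<mu> m \<one>\<^bsub>P\<^esub> = \<one>\<^bsub>S\<^esub>"
      using ring_hom_one[OF eval_ring_hom[OF sS]] by (simp add: psi_eval)
  qed (simp_all add: psi_eval)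
  interpret psi: ring_hom_ring P S "psi \<mu> m"
    by (intro ring_hom_ringI2 hom P.ring_axioms S.ring_axioms)
  have "inj_on (psi \<mu> m) (carrier P)"
  proof (rule psi.trivial_ker_imp_inj)
    \<comment> \<open>Uniqueness of the expansion handles the coefficients up to the degree, over
      which \<open>psi\<close> sums; those above it vanish because of the degree.\<close>
    have "p = \<zero>\<^bsub>P\<^esub>" if p: "p \<in> carrier P" "psi \<mu> m p = 0" for p
    proof (rule up_eqI[OF _ p(1) P.zero_closed])
      fix n
      have sum0: "(\<Sum>i<Suc (deg R p). shuffle (up_ring.coeff P p i) (shuffle_pow s i)) = 0"
        using p(2) unfolding psi_sum lessThan_Suc_atMost .
      have "deriv_Y (up_ring.coeff P p i) = 0" for i
        using coeff[OF p(1)] by (simp add: pos_kernel_def)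
      from power_expansion_unique[OF s(2) this sum0]
      have "up_ring.coeff P p n = 0" if "n \<le> deg R p"
        using that by simp
      then show "up_ring.coeff P p n = up_ring.coeff P \<zero>\<^bsub>P\<^esub> n"
        using deg_aboveD[OF _ p(1), of n] by (cases "n \<le> deg R p") (simp_all add: R_def)
    qed
    moreover have "psi \<mu> m \<zero>\<^bsub>P\<^esub> = 0"
      by (simp only: psi.hom_zero zero_S)
    ultimately show "a_kernel P S (psi \<mu> m) = {\<zero>\<^bsub>P\<^esub>}"
      unfolding a_kernel_def' zero_S using P.zero_closed by blast
  qed
  moreover have "psi \<mu> m ` carrier P = carrier S"
  proof
    show "psi \<mu> m ` carrier P \<subseteq> carrier S"
      by auto
    show "carrier S \<subseteq> psi \<mu> m ` carrier P"
    proof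
      fix q assume "q \<in> carrier S"
      then have q: "q \<in> pos_module"
        by (simp add: S_def)
      \<comment> \<open>Words of the finite support have bounded length, and this bound limits the
        number of terms of the expansion.\<close>
      obtain n where n: "\<And>w. w \<in> Poly_Mapping.keys q \<Longrightarrow> length w < n"
        using finite_imageI[OF finite_keys, of length q] unfolding finite_nat_set_iff_bounded by blast
      obtain a where a: "\<And>i. a i \<in> pos_kernel" "q = (\<Sum>i<n. shuffle (a i) (shuffle_pow s i))"
        using power_expansion_exists[OF s(2,1) q n] by blast
      \<comment> \<open>A preimage is built monomial by monomial, using additivity of
        \<open>psi\<close>. This avoids determining the degree of the polynomial with coefficients
        \<open>a\<close>, some of which may be zero.\<close>
      have "(\<Sum>i<k. shuffle (a i) (shuffle_pow s i)) \<in> psi \<mu> m ` carrier P" for k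
      proof (induction k)
        case 0
        show ?case
          by (rule image_eqI[of _ _ "\<zero>\<^bsub>P\<^esub>"]) (simp_all add: zero_S)
      next
        case (Suc k)
        then obtain p where p: "p \<in> carrier P"
          "(\<Sum>i<k. shuffle (a i) (shuffle_pow s i)) = psi \<mu> m p"
          by auto
        have ak: "a k \<in> carrier R"
          using a by (simp add: R_def)
        then have "psi \<mu> m (monom P (a k) k) = shuffle (a k) (shuffle_pow s k)"
          using eval_monom[OF ak sS] by (simp add: psi_eval S_def nat_pow_shuffle_algebra)
        moreover have "psi \<mu> m (p \<oplus>\<^bsub>P\<^esub> monom P (a k) k) = psi \<mu> m p + psi \<mu> m (monom P (a k) k)"
          using p ak by (simp add: S_def)
        ultimately show ?case
          using p ak by (intro image_eqI[of _ _ "p \<oplus>\<^bsub>P\<^esub> monom P (a k) k"]) simp_all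
      qed
      then show "q \<in> psi \<mu> m ` carrier P"
        using a(2) by simp
    qed
  qed
  ultimately have iso: "psi \<mu> m \<in> ring_iso P S"
    using hom by (simp add: ring_iso_def bij_betw_def)
  have alg1: "algebra R S"
    by (rule algebraI)
       (use cring0 cring1 in \<open>simp_all add: R_def S_def sub pos_module_shuffle shuffle_assoc
          shuffle_linear\<close>)
  have "psi \<mu> m (r \<odot>\<^bsub>P\<^esub> p) = r \<odot>\<^bsub>S\<^esub> psi \<mu> m p" if "r \<in> carrier R" "p \<in> carrier P" for r p
    using that Eval_smult[OF that] by (simp add: psi_eval S_def)
  with iso alg1 UP_algebra show ?thesis
    by (simp add: algebra_iso_def A0 A1 R_def S_def P_def)
qed

end
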